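(* Assume (A1)–(A4) (stated in the context). Let $p\in(0,1)$, $L\in\mathbb N$, $\gamma_L:=2^{-\alpha L}$ and $n_L:=n_{p,\gamma_L}=n_0\,2^{\alpha\beta L}\log(p^{-1})$, and define the single-level approximation $\tilde g_L^{\mathrm{SL}}:=P^{n_L}_{\mathcal M_{\gamma_L}}g_L$, which uses $n_L$ evaluations of $g_L$. Let $\tau_L^{\mathrm{SL}}$ be the work required to compute $\tilde g_L^{\mathrm{SL}}$ (counted as $n_L\tau_L$) and let $\omega_L^{\mathrm{SL}}:=\tau_L^{\mathrm{SL}}/\tau_L$ be the work overhead. Then the single-level approximation satisfies the error bound $$\|g-\tilde g_L^{\mathrm{SL}}\|_{L^2(\mu)}\lesssim 2^{-\alpha L}$$ with probability $1-p$ and a work overhead bounded by $$\omega_L^{\mathrm{SL}}\lesssim 2^{\alpha\beta L}\log(p^{-1}).$$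
   Context: Notation. $\lesssim$ and $\asymp$ denote inequality and two-sided equivalence up to positive multiplicative constants that do not depend on the level ($L$ or $l$). PDE setting. $D\subset\mathbb R^d$ is a bounded Lipschitz domain, $M\in\mathbb N$, $M>0$, $U=[-1,1]^M$, and $a(x,\boldsymbol y)=a_0(x)+\sum_{m=1}^M \boldsymbol y_m a_m(x)$ is uniformly elliptic, i.e. $0<r\le a(x,\boldsymbol y)\le R<\infty$ on $D\times U$. Let $V=H^1_0(D)$, $f\in V^*$, $G\in V^*$. For $\boldsymbol y\in U$, $u(\boldsymbol y)\in V$ is the solution of $\int_D a(x,\boldsymbol y)\nabla u(\boldsymbol y)\cdot\nabla v\,\mathrm dx=\langle f,v\rangle_{V^*,V}$ for all $v\in V$. $V_0\subset V_1\subset\cdots\subset V$ are nested finite-dimensional subspaces whose union is dense in $V$, and $u_l(\boldsymbol y)\in V_l$ is the Galerkin solution (same equation, test functions $v\in V_l$). Quantities of interest: $g(\boldsymbol y):=G(u(\boldsymbol y))$, $g_l(\boldsymbol y):=G(u_l(\boldsymbol y))$. Approximation setting. $\mu$ is a probability measure on $U$. $\mathcal S\subseteq L^\infty(\mu)$ is a quasi-normed space with $g\in\mathcal S$ and $g_l\in\mathcal S$ for all $l\in\mathbb N$. $\{\mathcal M_\gamma\}_{\gamma>0}$ is a family of model classes (sets of functions on $U$). $w\ge0$ is any weight function with $\int w^{-1}\,\mathrm d\mu=1$. For $n\in\mathbb N$ and i.i.d. sample points $\boldsymbol y_1,\dots,\boldsymbol y_n\sim w^{-1}\mu$ set $\|v\|_n:=\big(\frac1n\sum_{i=1}^n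 w(\boldsymbol y_i)|v(\boldsymbol y_i)|^2\big)^{1/2}$, and let $P^n_{\mathcal M_\gamma}z\in\arg\min_{v\in\mathcal M_\gamma}\|z-v\|_n$ denote the (random) weighted least squares approximation of $z$. Assumptions. (A1) There exist constants $A,\alpha>0$ such that $\|g-g_l\|_{\mathcal S}\le A2^{-\alpha l}$ for all $l\in\mathbb N$. (A2) There exists $C>0$ such that $\inf_{v\in\mathcal M_\gamma}\|z-v\|_{L^\infty(\mu)}\le C\gamma\|z\|_{\mathcal S}$ for all $\gamma>0$ and $z\in\mathcal S$. (A3) There exist $B,\beta>0$ such that for all $p\in(0,1)$ and $\gamma>0$ there exist $n_0,n_{p,\gamma}\in\mathbb N$ with $n_{p,\gamma}\le n_0\gamma^{-\beta}\log(p^{-1})$ and $\|z-P^{n_{p,\gamma}}_{\mathcal M_\gamma}z\|_{L^2(\mu)}\le B\inf_{v\in\mathcal M_\gamma}\|z-v\|_{L^\infty(\mu)}$ with probability $1-p$ for every $z\in L^\infty(\mu)\subseteq L^2(\mu)$. (A4) There exists $\delta>\alpha\beta$ such that the computation time $\tau_l$ of $g_l(\boldsymbol y)$ is independent of $\boldsymbol y$ and satisfies $\tau_l\asymp2^{\delta l}$ for all $\boldsymbol y\in U$.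
   Formalization: The inclusion of S in L^∞(μ) is taken to be continuous (the L^∞ norm is at most a constant times the quasi-norm of S), without which the error bound can fail; and n_0 in (A3) is one constant for all p and γ. *)

theory Defs
  imports "HOL-Probability.Probability"
begin

section \<open>Lebesgue spaces\<close>

text \<open>
  Members of Lebesgue and Sobolev spaces are represented by functions, not by equivalence classes.
  Both norms below are extended-real valued and equal \<open>\<infinity>\<close> outside the respective space, in
  particular on non-measurable functions.
\<close>

definition L2_space :: "'x measure \<Rightarrow> ('x \<Rightarrow> real) set" where
  "L2_space M = {v \<in> borel_measurable M. integrable M (\<lambda>x. (v x)\<^sup>2)}"

definition L2_enorm :: "'x measure \<Rightarrow> ('x \<Rightarrow> real) \<Rightarrow> ereal" where
  "L2_enorm M v = (if v \<in> L2_space M then ereal (sqrt (\<integral>x. (v x)\<^sup>2 \<partial>M)) else \<infinity>)"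

definition Linf_enorm :: "'x measure \<Rightarrow> ('x \<Rightarrow> real) \<Rightarrow> ereal" where
  "Linf_enorm M v = (if v \<in> borel_measurable M then esssup M (\<lambda>x. ereal \<bar>v x\<bar>) else \<infinity>)"

definition Linf_space :: "'x measure \<Rightarrow> ('x \<Rightarrow> real) set" where
  "Linf_space M = {v \<in> borel_measurable M. Linf_enorm M v < \<infinity>}"

section \<open>Lipschitz domains and the space of H1 functions vanishing on the boundary\<close>

text \<open>Near each boundary point, in suitably rotated coordinates, the domain lies strictly above the
  graph of a Lipschitz function of the coordinates orthogonal to the direction \<open>\<nu>\<close>.\<close>

definition bounded_lipschitz_domain :: "(real ^ 'd) set \<Rightarrow> bool" where
  "bounded_lipschitz_domain D \<longleftrightarrow>
     open D \<and> connected D \<and> D \<noteq> {} \<and> bounded D \<and>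
     (\<forall>x \<in> frontier D. \<exists>N \<nu> \<phi> K.
        open N \<and> x \<in> N \<and> norm \<nu> = 1 \<and> K-lipschitz_on {z. z \<bullet> \<nu> = 0} \<phi> \<and>
        D \<inter> N = {z \<in> N. (\<phi> (z - (z \<bullet> \<nu>) *\<^sub>R \<nu>) :: real) < z \<bullet> \<nu>})"

definition partial_deriv :: "'d \<Rightarrow> (real ^ 'd \<Rightarrow> real) \<Rightarrow> real ^ 'd \<Rightarrow> real" where
  "partial_deriv i \<phi> x = frechet_derivative \<phi> (at x) (axis i 1)"

primrec C_k :: "nat \<Rightarrow> (real ^ 'd \<Rightarrow> real) \<Rightarrow> bool" where
  "C_k 0 \<phi> \<longleftrightarrow> continuous_on UNIV \<phi>"
| "C_k (Suc k) \<phi> \<longleftrightarrow> (\<forall>x. \<phi> differentiable (at x)) \<and> (\<forall>i. C_k k (partial_deriv i \<phi>))"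

definition test_functions :: "(real ^ 'd) set \<Rightarrow> (real ^ 'd \<Rightarrow> real) set" where
  "test_functions D =
     {\<phi>. (\<forall>k. C_k k \<phi>) \<and> compact (closure {x. \<phi> x \<noteq> 0}) \<and> closure {x. \<phi> x \<noteq> 0} \<subseteq> D}"

definition has_weak_grad ::
    "(real ^ 'd) set \<Rightarrow> (real ^ 'd \<Rightarrow> real) \<Rightarrow> (real ^ 'd \<Rightarrow> real ^ 'd) \<Rightarrow> bool" where
  "has_weak_grad D v q \<longleftrightarrow>
     (\<forall>i. (\<lambda>x. q x $ i) \<in> L2_space (lebesgue_on D) \<and>
          (\<forall>\<phi> \<in> test_functions D.
             (\<integral>x. v x * partial_deriv i \<phi> x \<partial>lebesgue_on D) =
             - (\<integral>x. q x $ i * \<phi> x \<partial>lebesgue_on D)))"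

definition H1 :: "(real ^ 'd) set \<Rightarrow> (real ^ 'd \<Rightarrow> real) set" where
  "H1 D = {v \<in> L2_space (lebesgue_on D). \<exists>q. has_weak_grad D v q}"

text \<open>The weak gradient is unique up to a null set, so the choice is immaterial under integrals.\<close>

definition weak_grad :: "(real ^ 'd) set \<Rightarrow> (real ^ 'd \<Rightarrow> real) \<Rightarrow> real ^ 'd \<Rightarrow> real ^ 'd" where
  "weak_grad D v = (SOME q. has_weak_grad D v q)"

definition H1_norm :: "(real ^ 'd) set \<Rightarrow> (real ^ 'd \<Rightarrow> real) \<Rightarrow> real" where
  "H1_norm D v =
     sqrt ((\<integral>x. (v x)\<^sup>2 \<partial>lebesgue_on D) + (\<integral>x. (norm (weak_grad D v x))\<^sup>2 \<partial>lebesgue_on D))"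

definition H10 :: "(real ^ 'd) set \<Rightarrow> (real ^ 'd \<Rightarrow> real) set" where
  "H10 D = {v \<in> H1 D. \<forall>\<epsilon>>0. \<exists>\<phi> \<in> test_functions D. H1_norm D (\<lambda>x. v x - \<phi> x) < \<epsilon>}"

text \<open>Boundedness makes the functional independent of the choice of representatives.\<close>

definition H10_dual :: "(real ^ 'd) set \<Rightarrow> ((real ^ 'd \<Rightarrow> real) \<Rightarrow> real) set" where
  "H10_dual D = {F.
     (\<forall>v \<in> H10 D. \<forall>v' \<in> H10 D. F (\<lambda>x. v x + v' x) = F v + F v') \<and>
     (\<forall>c. \<forall>v \<in> H10 D. F (\<lambda>x. c * v x) = c * F v) \<and>
     (\<exists>K. \<forall>v \<in> H10 D. \<bar>F v\<bar> \<le> K * H1_norm D v)}"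

section \<open>The parametric diffusion problem\<close>

definition param_cube :: "(real ^ 'm) set" where
  "param_cube = {y. \<forall>m. y $ m \<in> {-1..1}}"

definition diffusion ::
    "(real ^ 'd \<Rightarrow> real) \<Rightarrow> ('m::finite \<Rightarrow> real ^ 'd \<Rightarrow> real) \<Rightarrow> real ^ 'd \<Rightarrow> real ^ 'm \<Rightarrow> real" where
  "diffusion a0 a x y = a0 x + (\<Sum>m\<in>UNIV. y $ m * a m x)"

definition uniformly_elliptic ::
    "(real ^ 'd) set \<Rightarrow> (real ^ 'd \<Rightarrow> real) \<Rightarrow> ('m::finite \<Rightarrow> real ^ 'd \<Rightarrow> real) \<Rightarrow> bool" where
  "uniformly_elliptic D a0 a \<longleftrightarrow>
     a0 \<in> borel_measurable (lebesgue_on D) \<and>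
     (\<forall>m. a m \<in> borel_measurable (lebesgue_on D)) \<and>
     (\<exists>r R. 0 < r \<and> (\<forall>x\<in>D. \<forall>y\<in>param_cube. r \<le> diffusion a0 a x y \<and> diffusion a0 a x y \<le> R))"

text \<open>With \<open>W = H10 D\<close> this is the weak solution, with \<open>W\<close> a finite-dimensional subspace the
  Galerkin solution.\<close>

definition galerkin_solution ::
    "(real ^ 'd) set \<Rightarrow> (real ^ 'd \<Rightarrow> real) \<Rightarrow> ('m::finite \<Rightarrow> real ^ 'd \<Rightarrow> real) \<Rightarrow>
     ((real ^ 'd \<Rightarrow> real) \<Rightarrow> real) \<Rightarrow> (real ^ 'd \<Rightarrow> real) set \<Rightarrow> real ^ 'm \<Rightarrow>
     (real ^ 'd \<Rightarrow> real) \<Rightarrow> bool" where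
  "galerkin_solution D a0 a f W y u \<longleftrightarrow>
     u \<in> W \<and>
     (\<forall>v \<in> W.
        (\<integral>x. diffusion a0 a x y * (weak_grad D u x \<bullet> weak_grad D v x) \<partial>lebesgue_on D) = f v)"

text \<open>The finite-dimensional spaces are spanned by fixed representatives; nested spaces of equivalence
  classes always have such spans that are nested as sets of functions.\<close>

definition galerkin_spaces ::
    "(real ^ 'd) set \<Rightarrow> (nat \<Rightarrow> (real ^ 'd \<Rightarrow> real) set) \<Rightarrow> bool" where
  "galerkin_spaces D V \<longleftrightarrow>
     (\<forall>l. V l \<subseteq> H10 D) \<and>
     (\<forall>l. V l \<subseteq> V (Suc l)) \<and>
     (\<forall>l. \<exists>B. finite B \<and> V l = {v. \<exists>c. v = (\<lambda>x. \<Sum>b\<in>B. c b * b x)}) \<and>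
     (\<forall>v \<in> H10 D. \<forall>\<epsilon>>0. \<exists>l. \<exists>v' \<in> V l. H1_norm D (\<lambda>x. v x - v' x) < \<epsilon>)"

section \<open>Quasi-normed spaces of functions modulo null sets\<close>

definition quasi_normed_space ::
    "'x measure \<Rightarrow> ('x \<Rightarrow> real) set \<Rightarrow> (('x \<Rightarrow> real) \<Rightarrow> real) \<Rightarrow> bool" where
  "quasi_normed_space M S N \<longleftrightarrow>
     S \<subseteq> borel_measurable M \<and>
     (\<forall>v \<in> S. \<forall>v' \<in> borel_measurable M. (AE x in M. v x = v' x) \<longrightarrow> v' \<in> S \<and> N v' = N v) \<and>
     (\<lambda>x. 0) \<in> S \<and>
     (\<forall>v \<in> S. \<forall>v' \<in> S. (\<lambda>x. v x + v' x) \<in> S) \<and>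
     (\<forall>c. \<forall>v \<in> S. (\<lambda>x. c * v x) \<in> S) \<and>
     (\<forall>v \<in> S. 0 \<le> N v \<and> (N v = 0 \<longleftrightarrow> (AE x in M. v x = 0))) \<and>
     (\<forall>c. \<forall>v \<in> S. N (\<lambda>x. c * v x) = \<bar>c\<bar> * N v) \<and>
     (\<exists>K\<ge>1. \<forall>v \<in> S. \<forall>v' \<in> S. N (\<lambda>x. v x + v' x) \<le> K * (N v + N v'))"

text \<open>Inclusion of a quasi-normed space in the essentially bounded functions, as topological vector
  spaces: a subset with continuous inclusion map.\<close>

definition embedded_in_Linf ::
    "'x measure \<Rightarrow> ('x \<Rightarrow> real) set \<Rightarrow> (('x \<Rightarrow> real) \<Rightarrow> real) \<Rightarrow> bool" where
  "embedded_in_Linf M S N \<longleftrightarrow>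
     S \<subseteq> Linf_space M \<and> (\<exists>K. \<forall>v \<in> S. Linf_enorm M v \<le> ereal (K * N v))"

section \<open>Weighted least squares\<close>

text \<open>The reciprocal is taken in \<^typ>\<open>ennreal\<close>, where \<open>inverse 0 = \<infinity>\<close>; a unit integral of the
  reciprocal thus forces a weight to be positive almost everywhere.\<close>

definition weight_function :: "'x measure \<Rightarrow> ('x \<Rightarrow> real) \<Rightarrow> bool" where
  "weight_function M w \<longleftrightarrow>
     w \<in> borel_measurable M \<and> (\<forall>x \<in> space M. 0 \<le> w x) \<and>
     (\<integral>\<^sup>+x. inverse (ennreal (w x)) \<partial>M) = 1"

text \<open>Joint law of the \<open>n\<close> independent sample points, indexed by \<open>{..<n}\<close>.\<close>

definition sample_measure :: "'x measure \<Rightarrow> ('x \<Rightarrow> real) \<Rightarrow> nat \<Rightarrow> (nat \<Rightarrow> 'x) measure" where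
  "sample_measure M w n = (\<Pi>\<^sub>M i\<in>{..<n}. density M (\<lambda>x. inverse (ennreal (w x))))"

definition emp_norm :: "('x \<Rightarrow> real) \<Rightarrow> nat \<Rightarrow> (nat \<Rightarrow> 'x) \<Rightarrow> ('x \<Rightarrow> real) \<Rightarrow> real" where
  "emp_norm w n ys v = sqrt (1 / real n * (\<Sum>i<n. w (ys i) * \<bar>v (ys i)\<bar>\<^sup>2))"

text \<open>\<open>P n \<gamma> z ys\<close> is the weighted least squares approximation of \<open>z\<close> in the model class \<open>Mc \<gamma>\<close> from
  the sample points \<open>ys\<close>. Minimisers need not be unique; \<open>P\<close> selects one.\<close>

definition least_squares_approx ::
    "'x measure \<Rightarrow> ('x \<Rightarrow> real) \<Rightarrow> (real \<Rightarrow> ('x \<Rightarrow> real) set) \<Rightarrow>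
     (nat \<Rightarrow> real \<Rightarrow> ('x \<Rightarrow> real) \<Rightarrow> (nat \<Rightarrow> 'x) \<Rightarrow> ('x \<Rightarrow> real)) \<Rightarrow> bool" where
  "least_squares_approx M w Mc P \<longleftrightarrow>
     (\<forall>n. \<forall>\<gamma>>0. \<forall>z \<in> Linf_space M. \<forall>ys \<in> space (sample_measure M w n).
        is_arg_min (\<lambda>v. emp_norm w n ys (\<lambda>x. z x - v x)) (\<lambda>v. v \<in> Mc \<gamma>) (P n \<gamma> z ys))"

definition best_error :: "'x measure \<Rightarrow> ('x \<Rightarrow> real) set \<Rightarrow> ('x \<Rightarrow> real) \<Rightarrow> ereal" where
  "best_error M F z = (INF v\<in>F. Linf_enorm M (\<lambda>x. z x - v x))"

text \<open>\<open>Q\<close> holds with probability at least \<open>q\<close>; the set where \<open>Q\<close> holds need not be measurable.\<close>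

definition with_prob :: "'x measure \<Rightarrow> real \<Rightarrow> ('x \<Rightarrow> bool) \<Rightarrow> bool" where
  "with_prob M q Q \<longleftrightarrow> (\<exists>E \<in> sets M. q \<le> measure M E \<and> (\<forall>x \<in> E. Q x))"

section \<open>Single-level approximation\<close>

definition level_gamma :: "real \<Rightarrow> nat \<Rightarrow> real" where
  "level_gamma \<alpha> L = 2 powr (- \<alpha> * real L)"

text \<open>\<open>n\<close> evaluations, each of cost \<open>t\<close>.\<close>

definition sl_work :: "nat \<Rightarrow> real \<Rightarrow> real" where
  "sl_work n t = real n * t"

definition work_overhead :: "real \<Rightarrow> real \<Rightarrow> real" where
  "work_overhead work t = work / t"

end

theory Submission
  imports Defs
begin

text \<open>
  The error is split at the Galerkin quantity of interest: with \<open>\<gamma>\<^sub>L = 2 powr (- \<alpha> L)\<close>,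
  \<open>g - P g\<^sub>L = (g - g\<^sub>L) + (g\<^sub>L - P g\<^sub>L)\<close>. The first summand is deterministic. On a probability space
  the \<open>L\<^sup>2\<close> norm is at most the \<open>L\<^sup>\<infinity>\<close> norm (\<open>L2_enorm_le_Linf_enorm\<close>), which the embedding of \<open>\<S>\<close>
  bounds by the quasi-norm, and the latter decays like \<open>2 powr (- \<alpha> L)\<close> by the
  convergence of the Galerkin method. The second summand is, on the event given by the stability of
  least squares, at most \<open>B\<close> times the best uniform error, hence at most \<open>B C \<gamma>\<^sub>L \<parallel>g\<^sub>L\<parallel>\<^sub>\<S>\<close>. Here
  \<open>\<parallel>g\<^sub>L\<parallel>\<^sub>\<S>\<close> is bounded independently of \<open>L\<close> because \<open>g\<^sub>L\<close> stays within quasi-norm distance \<open>A\<close> of \<open>g\<close>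
  (\<open>quasi_norm_le_of_diff_le\<close>). As \<open>g\<close> and \<open>g\<^sub>L\<close> are fixed, the stability event for the single
  function \<open>g\<^sub>L\<close> is already the event wanted, so that no probability is lost, and Minkowski's
  inequality (\<open>L2_enorm_triangle\<close>) adds the two bounds.

  Choosing the accuracy \<open>\<gamma>\<^sub>L\<close> of the model class equal to the discretisation error balances the two
  contributions. The work overhead is the number of samples, and \<open>\<gamma>\<^sub>L powr (- \<beta>) = 2 powr (\<alpha> \<beta> L)\<close>.
\<close>

section \<open>Norms on Lebesgue spaces\<close>

lemma L2_enorm_nonneg: "0 \<le> L2_enorm M v"
  by (simp add: L2_enorm_def)

text \<open>The pointwise inequality \<open>(a + b)\<^sup>2 \<le> (1 + t / s) a\<^sup>2 + (1 + s / t) b\<^sup>2\<close> integrates to Minkowski's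
  inequality when \<open>s\<close> and \<open>t\<close> are the two norms. Upper bounds \<open>s\<close> and \<open>t\<close> of the norms serve
  equally well and can be kept positive, which avoids the degenerate case of a vanishing norm.\<close>

lemma integral_square_add_le:
  fixes v v' :: "'x \<Rightarrow> real"
  assumes v: "v \<in> L2_space M" and v': "v' \<in> L2_space M"
    and "0 < s" "0 < t" "(\<integral>x. (v x)\<^sup>2 \<partial>M) \<le> s\<^sup>2" "(\<integral>x. (v' x)\<^sup>2 \<partial>M) \<le> t\<^sup>2"
  shows "(\<lambda>x. v x + v' x) \<in> L2_space M" and "(\<integral>x. (v x + v' x)\<^sup>2 \<partial>M) \<le> (s + t)\<^sup>2"
proof -
  have [measurable]: "v \<in> borel_measurable M" "v' \<in> borel_measurable M"
    and iv: "integrable M (\<lambda>x. (v x)\<^sup>2)" and iv': "integrable M (\<lambda>x. (v' x)\<^sup>2)"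
    using v v' by (auto simp: L2_space_def)
  have pw: "(v x + v' x)\<^sup>2 \<le> (1 + t / s) * (v x)\<^sup>2 + (1 + s / t) * (v' x)\<^sup>2" for x
  proof -
    have "0 \<le> (t * v x - s * v' x)\<^sup>2 / (s * t)"
      using \<open>0 < s\<close> \<open>0 < t\<close> by simp
    also have "\<dots> = (1 + t / s) * (v x)\<^sup>2 + (1 + s / t) * (v' x)\<^sup>2 - (v x + v' x)\<^sup>2"
      using \<open>0 < s\<close> \<open>0 < t\<close> by (simp add: field_simps power2_eq_square)
    finally show ?thesis by simp
  qed
  have int_bound: "integrable M (\<lambda>x. (1 + t / s) * (v x)\<^sup>2 + (1 + s / t) * (v' x)\<^sup>2)"
    using iv iv' by simp
  have int_sum: "integrable M (\<lambda>x. (v x + v' x)\<^sup>2)"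
    by (rule Bochner_Integration.integrable_bound[OF int_bound])
      (use pw in \<open>auto intro!: AE_I2 order_trans[OF pw abs_ge_self]\<close>)
  then show "(\<lambda>x. v x + v' x) \<in> L2_space M"
    by (simp add: L2_space_def)
  have "(\<integral>x. (v x + v' x)\<^sup>2 \<partial>M) \<le> (\<integral>x. (1 + t / s) * (v x)\<^sup>2 + (1 + s / t) * (v' x)\<^sup>2 \<partial>M)"
    by (rule integral_mono[OF int_sum int_bound pw])
  also have "\<dots> = (1 + t / s) * (\<integral>x. (v x)\<^sup>2 \<partial>M) + (1 + s / t) * (\<integral>x. (v' x)\<^sup>2 \<partial>M)"
    using iv iv' by simp
  also have "\<dots> \<le> (1 + t / s) * s\<^sup>2 + (1 + s / t) * t\<^sup>2"
    using assms(3-6) by (intro add_mono mult_left_mono) auto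
  also have "\<dots> = (s + t)\<^sup>2"
    using \<open>0 < s\<close> \<open>0 < t\<close> by (simp add: field_simps power2_eq_square)
  finally show "(\<integral>x. (v x + v' x)\<^sup>2 \<partial>M) \<le> (s + t)\<^sup>2" .
qed

lemma L2_enorm_triangle:
  "L2_enorm M (\<lambda>x. v x + v' x) \<le> L2_enorm M v + L2_enorm M v'"
proof (cases "v \<in> L2_space M \<and> v' \<in> L2_space M")
  case True
  define a b where "a = sqrt (\<integral>x. (v x)\<^sup>2 \<partial>M)" and "b = sqrt (\<integral>x. (v' x)\<^sup>2 \<partial>M)"
  have ab: "0 \<le> a" "0 \<le> b" "(\<integral>x. (v x)\<^sup>2 \<partial>M) = a\<^sup>2" "(\<integral>x. (v' x)\<^sup>2 \<partial>M) = b\<^sup>2"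
    by (simp_all add: a_def b_def)
  \<comment> \<open>Enlarging both norms by \<open>e\<close> makes them positive; \<open>e\<close> tends to 0 below.\<close>
  have sum: "(\<lambda>x. v x + v' x) \<in> L2_space M"
       "(\<integral>x. (v x + v' x)\<^sup>2 \<partial>M) \<le> ((a + e) + (b + e))\<^sup>2" if "0 < e" for e
    using integral_square_add_le[of v M v' "a + e" "b + e"] True ab that by (auto intro: power_mono)
  have "sqrt (\<integral>x. (v x + v' x)\<^sup>2 \<partial>M) \<le> a + b"
  proof (rule field_le_epsilon)
    fix e :: real assume "0 < e"
    then have "sqrt (\<integral>x. (v x + v' x)\<^sup>2 \<partial>M) \<le> (a + e / 2) + (b + e / 2)"
      using ab sum(2)[of "e / 2"] by (intro real_le_lsqrt) auto
    then show "sqrt (\<integral>x. (v x + v' x)\<^sup>2 \<partial>M) \<le> a + b + e" by simp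
  qed
  then show ?thesis
    using True sum(1)[of 1] by (simp add: L2_enorm_def a_def b_def)
next
  case False
  then have "L2_enorm M v + L2_enorm M v' = \<infinity>"
    using L2_enorm_nonneg[of M v] L2_enorm_nonneg[of M v'] by (auto simp: L2_enorm_def)
  then show ?thesis by (simp only: ereal_less_eq)
qed

lemma (in prob_space) L2_enorm_le_Linf_enorm:
  assumes "Linf_enorm M v \<le> ereal c"
  shows "L2_enorm M v \<le> ereal c"
proof -
  have [measurable]: "v \<in> borel_measurable M"
    using assms by (auto simp: Linf_enorm_def split: if_splits)
  have "AE x in M. ereal \<bar>v x\<bar> \<le> esssup M (\<lambda>x. ereal \<bar>v x\<bar>)"
    by (rule esssup_AE)
  then have bound: "AE x in M. \<bar>v x\<bar> \<le> c"
    using assms by (auto simp: Linf_enorm_def elim!: eventually_mono dest: order_trans)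
  have "AE x in M. 0 \<le> c"
    using bound by eventually_elim linarith
  then have "0 \<le> c" by simp
  have sq: "AE x in M. (v x)\<^sup>2 \<le> c\<^sup>2"
    using bound \<open>0 \<le> c\<close> by (auto elim!: eventually_mono simp: abs_le_square_iff[symmetric])
  have int: "integrable M (\<lambda>x. (v x)\<^sup>2)"
    by (rule integrable_const_bound[where B = "c\<^sup>2"]) (use sq in auto)
  have "(\<integral>x. (v x)\<^sup>2 \<partial>M) \<le> (\<integral>x. c\<^sup>2 \<partial>M)"
    by (rule integral_mono_AE[OF int _ sq]) simp
  also have "\<dots> = c\<^sup>2"
    by (simp add: prob_space)
  finally have "sqrt (\<integral>x. (v x)\<^sup>2 \<partial>M) \<le> c"
    using \<open>0 \<le> c\<close> by (intro real_le_lsqrt) auto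
  then show ?thesis
    using int by (simp add: L2_enorm_def L2_space_def)
qed

section \<open>Bounded sets in quasi-normed spaces\<close>

lemma quasi_normed_space_diff:
  assumes "quasi_normed_space M S N" "v \<in> S" "v' \<in> S"
  shows "(\<lambda>x. v x - v' x) \<in> S"
proof -
  have "(\<lambda>x. - 1 * v' x) \<in> S"
    using assms unfolding quasi_normed_space_def by blast
  moreover have "\<forall>z\<in>S. \<forall>z'\<in>S. (\<lambda>x. z x + z' x) \<in> S"
    using assms unfolding quasi_normed_space_def by blast
  ultimately have "(\<lambda>x. v x + - 1 * v' x) \<in> S"
    using \<open>v \<in> S\<close> by fast
  then show ?thesis by simp
qed

text \<open>The quasi-triangle inequality for \<open>v' = v - (v - v')\<close> gives a bound that does not change with
  \<open>v'\<close>. With \<open>v = g\<close> it controls all the discretisations \<open>g\<^sub>L\<close> at once.\<close>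

lemma quasi_norm_le_of_diff_le:
  assumes Q: "quasi_normed_space M S N" and "v \<in> S"
  obtains R where "0 \<le> R"
    and "\<And>v'. v' \<in> S \<Longrightarrow> N (\<lambda>x. v x - v' x) \<le> a \<Longrightarrow> N v' \<le> R"
proof -
  obtain K where "1 \<le> K"
    and K: "\<And>v v'. v \<in> S \<Longrightarrow> v' \<in> S \<Longrightarrow> N (\<lambda>x. v x + v' x) \<le> K * (N v + N v')"
    using Q unfolding quasi_normed_space_def by blast
  have scale: "(\<lambda>x. c * z x) \<in> S" "N (\<lambda>x. c * z x) = \<bar>c\<bar> * N z" if "z \<in> S" for c z
    using Q that unfolding quasi_normed_space_def by blast+
  have nonneg: "0 \<le> N v"
    using Q \<open>v \<in> S\<close> unfolding quasi_normed_space_def by blast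
  show thesis
  proof
    show "0 \<le> K * (N v + \<bar>a\<bar>)"
      using \<open>1 \<le> K\<close> nonneg by simp
    fix v' assume "v' \<in> S" and le: "N (\<lambda>x. v x - v' x) \<le> a"
    have d: "(\<lambda>x. v x - v' x) \<in> S"
      by (rule quasi_normed_space_diff[OF Q \<open>v \<in> S\<close> \<open>v' \<in> S\<close>])
    have "N v' = N (\<lambda>x. v x + - 1 * (v x - v' x))"
      by simp
    also have "\<dots> \<le> K * (N v + N (\<lambda>x. - 1 * (v x - v' x)))"
      by (rule K[OF \<open>v \<in> S\<close> scale(1)[OF d]])
    also have "\<dots> = K * (N v + N (\<lambda>x. v x - v' x))"
      using scale(2)[OF d, of "- 1"] by simp
    also have "\<dots> \<le> K * (N v + \<bar>a\<bar>)"
      using \<open>1 \<le> K\<close> le by (intro mult_left_mono) auto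
    finally show "N v' \<le> K * (N v + \<bar>a\<bar>)" .
  qed
qed

section \<open>Error and work of the single-level approximation\<close>

lemma with_prob_mono:
  assumes "with_prob M q Q" and "\<And>x. Q x \<Longrightarrow> Q' x"
  shows "with_prob M q Q'"
  using assms unfolding with_prob_def by blast

lemma level_gamma_pos: "0 < level_gamma \<alpha> L"
  by (simp add: level_gamma_def)

lemma level_gamma_powr: "level_gamma \<alpha> L powr (- \<beta>) = 2 powr (\<alpha> * \<beta> * real L)"
  by (simp add: level_gamma_def powr_powr algebra_simps)

theorem theorem1:
  fixes D :: "(real ^ 'd) set"
    and a0 :: "real ^ 'd \<Rightarrow> real"
    and a :: "'m::finite \<Rightarrow> real ^ 'd \<Rightarrow> real"
    and f G :: "(real ^ 'd \<Rightarrow> real) \<Rightarrow> real"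
    and u :: "real ^ 'm \<Rightarrow> real ^ 'd \<Rightarrow> real"
    and V :: "nat \<Rightarrow> (real ^ 'd \<Rightarrow> real) set"
    and ul :: "nat \<Rightarrow> real ^ 'm \<Rightarrow> real ^ 'd \<Rightarrow> real"
    and g :: "real ^ 'm \<Rightarrow> real"
    and gl :: "nat \<Rightarrow> real ^ 'm \<Rightarrow> real"
    and \<mu> :: "(real ^ 'm) measure"
    and S :: "(real ^ 'm \<Rightarrow> real) set"
    and normS :: "(real ^ 'm \<Rightarrow> real) \<Rightarrow> real"
    and Mc :: "real \<Rightarrow> (real ^ 'm \<Rightarrow> real) set"
    and w :: "real ^ 'm \<Rightarrow> real"
    and P :: "nat \<Rightarrow> real \<Rightarrow> (real ^ 'm \<Rightarrow> real) \<Rightarrow> (nat \<Rightarrow> real ^ 'm) \<Rightarrow> real ^ 'm \<Rightarrow> real"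
    and n :: "real \<Rightarrow> real \<Rightarrow> nat"
    and n0 :: nat
    and A \<alpha> B \<beta> C \<delta> :: real
    and time :: "nat \<Rightarrow> real ^ 'm \<Rightarrow> real"
    and \<tau> :: "nat \<Rightarrow> real"
  assumes "bounded_lipschitz_domain D"
    and "uniformly_elliptic D a0 a"
    and "f \<in> H10_dual D" and "G \<in> H10_dual D"
    and "\<And>y. y \<in> param_cube \<Longrightarrow> galerkin_solution D a0 a f (H10 D) y (u y)"
    and "galerkin_spaces D V"
    and "\<And>l y. y \<in> param_cube \<Longrightarrow> galerkin_solution D a0 a f (V l) y (ul l y)"
    and "g = (\<lambda>y. G (u y))"
    and "gl = (\<lambda>l y. G (ul l y))"
    and "prob_space \<mu>" and "sets \<mu> = sets (restrict_space borel param_cube)"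
    and "quasi_normed_space \<mu> S normS" and "embedded_in_Linf \<mu> S normS"
    and "g \<in> S" and "\<And>l. gl l \<in> S"
    and "weight_function \<mu> w"
    and "least_squares_approx \<mu> w Mc P"
    and "A > 0" and "\<alpha> > 0"
    and A1: "\<And>l. normS (\<lambda>y. g y - gl l y) \<le> A * 2 powr (- \<alpha> * real l)"
    and "C > 0"
    and A2: "\<And>\<gamma> z. \<gamma> > 0 \<Longrightarrow> z \<in> S \<Longrightarrow> best_error \<mu> (Mc \<gamma>) z \<le> ereal (C * \<gamma> * normS z)"
    and "B > 0" and "\<beta> > 0"
    and A3_size: "\<And>p \<gamma>. p \<in> {0<..<1} \<Longrightarrow> \<gamma> > 0 \<Longrightarrow>
           real (n p \<gamma>) \<le> real n0 * \<gamma> powr (- \<beta>) * ln (1 / p)"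
    and A3: "\<And>p \<gamma> z. p \<in> {0<..<1} \<Longrightarrow> \<gamma> > 0 \<Longrightarrow> z \<in> Linf_space \<mu> \<Longrightarrow>
           with_prob (sample_measure \<mu> w (n p \<gamma>)) (1 - p)
             (\<lambda>ys. L2_enorm \<mu> (\<lambda>y. z y - P (n p \<gamma>) \<gamma> z ys y) \<le> ereal B * best_error \<mu> (Mc \<gamma>) z)"
    and A4: "\<delta> > \<alpha> * \<beta>"
    and "\<And>l y. y \<in> param_cube \<Longrightarrow> time l y = \<tau> l"
    and "\<exists>c1>0. \<exists>c2>0. \<forall>l. c1 * 2 powr (\<delta> * real l) \<le> \<tau> l \<and> \<tau> l \<le> c2 * 2 powr (\<delta> * real l)"
  shows "(\<exists>c>0. \<forall>p\<in>{0<..<1}. \<forall>L.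
            let \<gamma>L = level_gamma \<alpha> L; nL = n p \<gamma>L in
              with_prob (sample_measure \<mu> w nL) (1 - p)
                (\<lambda>ys. L2_enorm \<mu> (\<lambda>y. g y - P nL \<gamma>L (gl L) ys y)
                        \<le> ereal (c * 2 powr (- \<alpha> * real L))))
       \<and> (\<exists>c>0. \<forall>p\<in>{0<..<1}. \<forall>L.
            let \<gamma>L = level_gamma \<alpha> L; nL = n p \<gamma>L in
              work_overhead (sl_work nL (\<tau> L)) (\<tau> L)
                \<le> c * 2 powr (\<alpha> * \<beta> * real L) * ln (1 / p))"
proof
  interpret prob_space \<mu> by fact
  note Q = \<open>quasi_normed_space \<mu> S normS\<close>
  note gl_S = \<open>\<And>l. gl l \<in> S\<close>
  have diff_S: "(\<lambda>y. g y - gl L y) \<in> S" for L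
    by (rule quasi_normed_space_diff[OF Q \<open>g \<in> S\<close> gl_S])
  have diff_nonneg: "0 \<le> normS (\<lambda>y. g y - gl L y)" for L
    using Q diff_S unfolding quasi_normed_space_def by blast
  have gl_Linf: "gl L \<in> Linf_space \<mu>" for L
    using \<open>embedded_in_Linf \<mu> S normS\<close> gl_S by (auto simp: embedded_in_Linf_def)
  obtain K where K: "\<And>v. v \<in> S \<Longrightarrow> Linf_enorm \<mu> v \<le> ereal (K * normS v)"
    using \<open>embedded_in_Linf \<mu> S normS\<close> unfolding embedded_in_Linf_def by blast
  have "normS (\<lambda>y. g y - gl L y) \<le> A" for L
  proof -
    have "2 powr (- \<alpha> * real L) \<le> 1"
      using powr_mono[of "- \<alpha> * real L" 0 2] \<open>\<alpha> > 0\<close> by simp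
    then have "A * 2 powr (- \<alpha> * real L) \<le> A * 1"
      using \<open>A > 0\<close> by (intro mult_left_mono) auto
    then show ?thesis
      using A1[of L] by simp
  qed
  then obtain R where "0 \<le> R" and R: "\<And>L. normS (gl L) \<le> R"
    using quasi_norm_le_of_diff_le[OF Q \<open>g \<in> S\<close>, of A] gl_S by metis

  have discretisation: "L2_enorm \<mu> (\<lambda>y. g y - gl L y) \<le> ereal (\<bar>K\<bar> * A * 2 powr (- \<alpha> * real L))" for L
  proof (rule L2_enorm_le_Linf_enorm)
    have "K * normS (\<lambda>y. g y - gl L y) \<le> \<bar>K\<bar> * (A * 2 powr (- \<alpha> * real L))"
      using A1[of L] diff_nonneg[of L] by (intro mult_mono) auto
    then have "ereal (K * normS (\<lambda>y. g y - gl L y)) \<le> ereal (\<bar>K\<bar> * A * 2 powr (- \<alpha> * real L))"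
      by (simp add: mult.assoc)
    with K[OF diff_S[of L]]
    show "Linf_enorm \<mu> (\<lambda>y. g y - gl L y) \<le> ereal (\<bar>K\<bar> * A * 2 powr (- \<alpha> * real L))"
      by (rule order_trans)
  qed

  have approximation: "ereal B * best_error \<mu> (Mc (level_gamma \<alpha> L)) (gl L)
      \<le> ereal (B * C * R * 2 powr (- \<alpha> * real L))" for L
  proof -
    have "ereal B * best_error \<mu> (Mc (level_gamma \<alpha> L)) (gl L)
        \<le> ereal B * ereal (C * level_gamma \<alpha> L * normS (gl L))"
      using \<open>B > 0\<close> A2[OF level_gamma_pos gl_S] by (intro ereal_mult_left_mono) auto
    also have "\<dots> = ereal (B * C * level_gamma \<alpha> L * normS (gl L))"
      by (simp add: mult.assoc)
    also have "\<dots> \<le> ereal (B * C * level_gamma \<alpha> L * R)"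
      using \<open>B > 0\<close> \<open>C > 0\<close> level_gamma_pos[of \<alpha> L] R[of L] by simp
    also have "B * C * level_gamma \<alpha> L * R = B * C * R * 2 powr (- \<alpha> * real L)"
      by (simp add: level_gamma_def)
    finally show ?thesis .
  qed

  \<comment> \<open>\<open>K\<close> and \<open>R\<close> may both be 0; the summand 1 keeps the constant positive.\<close>
  define c where "c = \<bar>K\<bar> * A + B * C * R + 1"
  have "c > 0"
    unfolding c_def using \<open>A > 0\<close> \<open>B > 0\<close> \<open>C > 0\<close> \<open>0 \<le> R\<close> by (intro add_nonneg_pos add_nonneg_nonneg) auto
  have "with_prob (sample_measure \<mu> w (n p (level_gamma \<alpha> L))) (1 - p)
         (\<lambda>ys. L2_enorm \<mu> (\<lambda>y. g y - P (n p (level_gamma \<alpha> L)) (level_gamma \<alpha> L) (gl L) ys y)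
                 \<le> ereal (c * 2 powr (- \<alpha> * real L)))" if "p \<in> {0<..<1}" for p L
  proof (rule with_prob_mono[OF A3[OF that level_gamma_pos gl_Linf]])
    fix ys
    let ?Pz = "P (n p (level_gamma \<alpha> L)) (level_gamma \<alpha> L) (gl L) ys"
    assume ls: "L2_enorm \<mu> (\<lambda>y. gl L y - ?Pz y)
      \<le> ereal B * best_error \<mu> (Mc (level_gamma \<alpha> L)) (gl L)"
    have "L2_enorm \<mu> (\<lambda>y. g y - ?Pz y)
        \<le> L2_enorm \<mu> (\<lambda>y. g y - gl L y) + L2_enorm \<mu> (\<lambda>y. gl L y - ?Pz y)"
      using L2_enorm_triangle[of \<mu> "\<lambda>y. g y - gl L y" "\<lambda>y. gl L y - ?Pz y"] by simp
    also have "\<dots> \<le> ereal (\<bar>K\<bar> * A * 2 powr (- \<alpha> * real L)) + ereal (B * C * R * 2 powr (- \<alpha> * real L))"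
      by (rule add_mono[OF discretisation order_trans[OF ls approximation]])
    also have "\<dots> \<le> ereal (c * 2 powr (- \<alpha> * real L))"
      by (simp add: c_def distrib_right)
    finally show "L2_enorm \<mu> (\<lambda>y. g y - ?Pz y) \<le> ereal (c * 2 powr (- \<alpha> * real L))" .
  qed
  with \<open>c > 0\<close> show "\<exists>c>0. \<forall>p\<in>{0<..<1}. \<forall>L.
            let \<gamma>L = level_gamma \<alpha> L; nL = n p \<gamma>L in
              with_prob (sample_measure \<mu> w nL) (1 - p)
                (\<lambda>ys. L2_enorm \<mu> (\<lambda>y. g y - P nL \<gamma>L (gl L) ys y)
                        \<le> ereal (c * 2 powr (- \<alpha> * real L)))"
    unfolding Let_def by blast
next
  have \<tau>_pos: "\<tau> L > 0" for L
  proof -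
    obtain c1 where "c1 > 0" and c1: "\<And>l. c1 * 2 powr (\<delta> * real l) \<le> \<tau> l"
      using \<open>\<exists>c1>0. \<exists>c2>0. \<forall>l. c1 * 2 powr (\<delta> * real l) \<le> \<tau> l \<and> \<tau> l \<le> c2 * 2 powr (\<delta> * real l)\<close>
      by blast
    have "0 < c1 * 2 powr (\<delta> * real L)"
      using \<open>c1 > 0\<close> by simp
    with c1[of L] show ?thesis by linarith
  qed
  \<comment> \<open>As \<open>n0\<close> may be 0, the constant is \<open>n0 + 1\<close>.\<close>
  have "work_overhead (sl_work (n p (level_gamma \<alpha> L)) (\<tau> L)) (\<tau> L)
      \<le> (real n0 + 1) * 2 powr (\<alpha> * \<beta> * real L) * ln (1 / p)" if p: "p \<in> {0<..<1}" for p L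
  proof -
    have "work_overhead (sl_work (n p (level_gamma \<alpha> L)) (\<tau> L)) (\<tau> L) = real (n p (level_gamma \<alpha> L))"
      using \<tau>_pos[of L] by (simp add: work_overhead_def sl_work_def)
    also have "\<dots> \<le> real n0 * 2 powr (\<alpha> * \<beta> * real L) * ln (1 / p)"
      using A3_size[OF p level_gamma_pos, of \<alpha> L] by (simp only: level_gamma_powr)
    also have "\<dots> \<le> (real n0 + 1) * 2 powr (\<alpha> * \<beta> * real L) * ln (1 / p)"
      using p by (intro mult_right_mono) auto
    finally show ?thesis .
  qed
  then show "\<exists>c>0. \<forall>p\<in>{0<..<1}. \<forall>L.
            let \<gamma>L = level_gamma \<alpha> L; nL = n p \<gamma>L in
              work_overhead (sl_work nL (\<tau> L)) (\<tau> L)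
                \<le> c * 2 powr (\<alpha> * \<beta> * real L) * ln (1 / p)"
    unfolding Let_def by (intro exI[of _ "real n0 + 1"]) auto
qed

end
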